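(* Let $M$ be the thrice-punctured disc and let $T_c,T_d:\mathbb{Z}^2\setminus\{0\}\to\mathbb{Z}^2\setminus\{0\}$ be the actions of the Dehn twists $t_c$ and $t_d$ on Dynnikov coordinates, i.e. $T_x(\rho(l))=\rho(t_x(l))$ for $l\in S$. Put $Q_2=\{(a,b)\in\mathbb{Z}^2\setminus\{0\}: a\le 0,\ b\ge 0\}$ (second quadrant) and $Q_4=\{(a,b)\in\mathbb{Z}^2\setminus\{0\}: a\ge 0,\ b\le 0\}$ (fourth quadrant). Then: (1) For every $(a,b)\in\mathbb{Z}^2\setminus\{0\}$ the sequence of iterates $T_c^n(a,b)$ flows into $Q_2$, i.e. there is $N\ge 0$ with $T_c^n(a,b)\in Q_2$ for all $n\ge N$; and the sequence $T_d^n(a,b)$ flows into $Q_4$, i.e. there is $N'\ge 0$ with $T_d^n(a,b)\in Q_4$ for all $n\ge N'$. (2) $Q_2$ is preserved by $T_c$ and $Q_4$ is preserved by $T_d$: $T_c(Q_2)\subseteq Q_2$ and $T_d(Q_4)\subseteq Q_4$.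
   Context: $M$ is a disc with three punctures $1,2,3$ placed from left to right on its horizontal diameter. A simple closed curve in $M$ is essential if it bounds neither a disc nor a once-punctured disc, nor an annulus together with $\partial M$. $S$ denotes the set of isotopy classes of nonempty finite unions of pairwise disjoint essential simple closed curves in $M$. Dynnikov coordinates. Let $\alpha_1$ (respectively $\alpha_2$) be the vertical arc from puncture $2$ up (respectively down) to $\partial M$; let $\beta_1$ (respectively $\beta_2$) be the vertical arc with both endpoints on $\partial M$ separating puncture $1$ from punctures $2,3$ (respectively punctures $1,2$ from puncture $3$). For $l\in S$ write $\alpha_i,\beta_i$ also for the minimal intersection number of $l$ with the corresponding arc. The Dynnikov coordinates of $l$ are $\rho(l)=(a,b)$ with $a=\frac{\alpha_2-\alpha_1}{2}$, $b=\frac{\beta_1-\beta_2}{2}$. It is known that $\rho:S\to\mathbb{Z}^2\setminus\{0\}$ is a bijection. Curves and twists. $c$ is the curve enclosing punctures $1,2$ and $d$ the curve enclosing punctures $2,3$ (boundaries of neighbourhoods of the straight segments joining these punctures); thus $\rho(c)=(0,1)$, $\rho(d)=(0,-1)$. Let $\sigma_i$ ($i=1,2$) be the half twist exchanging punctures $i$ and $i+1$ counterclockwise; then $t_c=\sigma_1^2$ and $t_d=\sigma_2^2$ are the Dehn twists about $c$ and $d$. In coordinates, $T_c$ is given by $T_c(a,b)=(b-a,-b)$ if $a\ge0,\ b\le a$; $(b-a,b-2a)$ if $0\le a\le b\le 2a$; $(a,b-2a)$ if $2a\le b,\ b\ge 0$; $(a+b,-2a-b)$ if $a\le 0,\ b\le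 0$; and $T_d$ is given by $T_d(a,b)=(b-a,-b)$ if $a\le0,\ a\le b$; $(b-a,b-2a)$ if $2a\le b\le a\le 0$; $(a,b-2a)$ if $b\le 2a,\ b\le 0$; $(a+b,-2a-b)$ if $a\ge 0,\ b\ge 0$. *)

theory Defs
  imports "HOL-Analysis.Analysis"
begin

section \<open>Multicurves in the thrice-punctured disc\<close>

definition punctures :: "complex set" where
  "punctures = {-1, 0, 1}"

definition M :: "complex set" where
  "M = cball 0 2 - punctures"

definition bdry_M :: "complex set" where
  "bdry_M = sphere 0 2"

definition bounds_disc_with_punctures :: "nat \<Rightarrow> complex set \<Rightarrow> bool" where
  "bounds_disc_with_punctures k \<gamma> \<longleftrightarrow>
     (\<exists>D f g. homeomorphism (cball (0::complex) 1) D f g \<and> f ` sphere 0 1 = \<gamma> \<and>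
        D \<subseteq> cball 0 2 \<and> card (D \<inter> punctures) = k)"

definition bounds_annulus_with_bdry :: "complex set \<Rightarrow> bool" where
  "bounds_annulus_with_bdry \<gamma> \<longleftrightarrow>
     (\<exists>A f g. homeomorphism (cball (0::complex) 2 - ball 0 1) A f g \<and>
        f ` sphere 0 1 = \<gamma> \<and> f ` sphere 0 2 = bdry_M \<and> A \<subseteq> M)"

text \<open>Curves are taken in the interior of \<open>M\<close>; in particular the boundary circle itself,
  which does not cobound an annulus with \<open>bdry_M\<close>, is not a curve.\<close>

definition simple_closed_curve :: "complex set \<Rightarrow> bool" where
  "simple_closed_curve \<gamma> \<longleftrightarrow> \<gamma> \<subseteq> M - bdry_M \<and>
     (\<exists>p. simple_path p \<and> pathfinish p = pathstart p \<and> path_image p = \<gamma>)"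

definition essential :: "complex set \<Rightarrow> bool" where
  "essential \<gamma> \<longleftrightarrow> \<not> bounds_disc_with_punctures 0 \<gamma> \<and>
     \<not> bounds_disc_with_punctures 1 \<gamma> \<and> \<not> bounds_annulus_with_bdry \<gamma>"

definition multicurve :: "complex set \<Rightarrow> bool" where
  "multicurve l \<longleftrightarrow> (\<exists>C. finite C \<and> C \<noteq> {} \<and> pairwise disjnt C \<and>
     (\<forall>\<gamma>\<in>C. simple_closed_curve \<gamma> \<and> essential \<gamma>) \<and> l = \<Union>C)"

definition isotopy_rel :: "(complex set \<times> complex set) set" where
  "isotopy_rel = {(l, l'). multicurve l \<and> multicurve l' \<and>
     (\<exists>h. homotopic_with_canon (\<lambda>f. \<exists>g. homeomorphism M M f g) M M id h \<and> h ` l = l')}"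

definition S :: "complex set set set" where
  "S = Collect multicurve // isotopy_rel"


section \<open>Dynnikov coordinates\<close>

definition alpha1 :: "complex set" where
  "alpha1 = {z \<in> M. Re z = 0 \<and> Im z > 0}"

definition alpha2 :: "complex set" where
  "alpha2 = {z \<in> M. Re z = 0 \<and> Im z < 0}"

definition beta1 :: "complex set" where
  "beta1 = {z \<in> M. Re z = -1/2}"

definition beta2 :: "complex set" where
  "beta2 = {z \<in> M. Re z = 1/2}"

text \<open>The finiteness condition matters, since \<open>card\<close> is \<open>0\<close> on infinite sets.\<close>

definition min_inter :: "complex set set \<Rightarrow> complex set \<Rightarrow> nat" where
  "min_inter L A = (LEAST n. \<exists>l\<in>L. finite (l \<inter> A) \<and> card (l \<inter> A) = n)"

text \<open>Both differences are even: a closed curve meets the separating sets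
  \<open>beta1\<close>, \<open>beta2\<close> and \<open>alpha1 \<union> alpha2\<close> an even number of times. So \<open>div 2\<close> is exact.\<close>

definition dynnikov :: "complex set set \<Rightarrow> int \<times> int" where
  "dynnikov L =
     ((int (min_inter L alpha2) - int (min_inter L alpha1)) div 2,
      (int (min_inter L beta1) - int (min_inter L beta2)) div 2)"

definition Z2_nonzero :: "(int \<times> int) set" where
  "Z2_nonzero = UNIV - {(0, 0)}"


section \<open>Dehn twists and their action on coordinates\<close>

text \<open>A half twist about \<open>p\<close>: the disc of radius \<open>1/2\<close>, which has the two exchanged punctures
  on its boundary, is rotated rigidly by \<open>pi\<close> counterclockwise; the angle decreases
  linearly to \<open>0\<close> at radius \<open>1\<close>, and the map is the identity further out.\<close>

definition half_twist :: "complex \<Rightarrow> complex \<Rightarrow> complex" where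
  "half_twist p z = p + (z - p) * cis (pi * max 0 (min 1 (2 - 2 * cmod (z - p))))"

definition sigma1 :: "complex \<Rightarrow> complex" where
  "sigma1 = half_twist (-1/2)"

definition sigma2 :: "complex \<Rightarrow> complex" where
  "sigma2 = half_twist (1/2)"

definition t_c :: "complex \<Rightarrow> complex" where
  "t_c = sigma1 \<circ> sigma1"

definition t_d :: "complex \<Rightarrow> complex" where
  "t_d = sigma2 \<circ> sigma2"

text \<open>\<open>act t\<close> is the action on isotopy classes. \<open>coord_action t\<close> is determined on
  \<open>Z2_nonzero\<close> by \<open>coord_action t (dynnikov L) = dynnikov (act t L)\<close> for \<open>L \<in> S\<close>, given that
  \<open>dynnikov\<close> is a bijection from \<open>S\<close> onto \<open>Z2_nonzero\<close>.\<close>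

definition act :: "(complex \<Rightarrow> complex) \<Rightarrow> complex set set \<Rightarrow> complex set set" where
  "act t L = (\<lambda>l. t ` l) ` L"

definition coord_action :: "(complex \<Rightarrow> complex) \<Rightarrow> int \<times> int \<Rightarrow> int \<times> int" where
  "coord_action t v = dynnikov (act t (inv_into S dynnikov v))"

fun Tc_formula :: "int \<times> int \<Rightarrow> int \<times> int" where
  "Tc_formula (a, b) =
     (if a \<ge> 0 \<and> b \<le> a then (b - a, -b)
      else if 0 \<le> a \<and> a \<le> b \<and> b \<le> 2 * a then (b - a, b - 2 * a)
      else if 2 * a \<le> b \<and> b \<ge> 0 then (a, b - 2 * a)
      else (a + b, -2 * a - b))"

fun Td_formula :: "int \<times> int \<Rightarrow> int \<times> int" where
  "Td_formula (a, b) =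
     (if a \<le> 0 \<and> a \<le> b then (b - a, -b)
      else if 2 * a \<le> b \<and> b \<le> a \<and> a \<le> 0 then (b - a, b - 2 * a)
      else if b \<le> 2 * a \<and> b \<le> 0 then (a, b - 2 * a)
      else (a + b, -2 * a - b))"

text \<open>The four cases cover the plane and agree where they overlap, so the order of the tests
  above is immaterial.\<close>

lemma Tc_formula_cases:
  "a \<ge> 0 \<Longrightarrow> b \<le> a \<Longrightarrow> Tc_formula (a, b) = (b - a, -b)"
  "0 \<le> a \<Longrightarrow> a \<le> b \<Longrightarrow> b \<le> 2 * a \<Longrightarrow> Tc_formula (a, b) = (b - a, b - 2 * a)"
  "2 * a \<le> b \<Longrightarrow> b \<ge> 0 \<Longrightarrow> Tc_formula (a, b) = (a, b - 2 * a)"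
  "a \<le> 0 \<Longrightarrow> b \<le> 0 \<Longrightarrow> Tc_formula (a, b) = (a + b, -2 * a - b)"
  "(a \<ge> 0 \<and> b \<le> a) \<or> (0 \<le> a \<and> a \<le> b \<and> b \<le> 2 * a) \<or> (2 * a \<le> b \<and> b \<ge> 0) \<or> (a \<le> 0 \<and> b \<le> 0)"
  by auto

lemma Td_formula_cases:
  "a \<le> 0 \<Longrightarrow> a \<le> b \<Longrightarrow> Td_formula (a, b) = (b - a, -b)"
  "2 * a \<le> b \<Longrightarrow> b \<le> a \<Longrightarrow> a \<le> 0 \<Longrightarrow> Td_formula (a, b) = (b - a, b - 2 * a)"
  "b \<le> 2 * a \<Longrightarrow> b \<le> 0 \<Longrightarrow> Td_formula (a, b) = (a, b - 2 * a)"
  "a \<ge> 0 \<Longrightarrow> b \<ge> 0 \<Longrightarrow> Td_formula (a, b) = (a + b, -2 * a - b)"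
  "(a \<le> 0 \<and> a \<le> b) \<or> (2 * a \<le> b \<and> b \<le> a \<and> a \<le> 0) \<or> (b \<le> 2 * a \<and> b \<le> 0) \<or> (a \<ge> 0 \<and> b \<ge> 0)"
  by auto


section \<open>Quadrants and flowing\<close>

definition Q2 :: "(int \<times> int) set" where
  "Q2 = {(a, b) \<in> Z2_nonzero. a \<le> 0 \<and> b \<ge> 0}"

definition Q4 :: "(int \<times> int) set" where
  "Q4 = {(a, b) \<in> Z2_nonzero. a \<ge> 0 \<and> b \<le> 0}"

definition flows_into :: "(int \<times> int \<Rightarrow> int \<times> int) \<Rightarrow> (int \<times> int) set \<Rightarrow> int \<times> int \<Rightarrow> bool" where
  "flows_into T Q v \<longleftrightarrow> (\<exists>N. \<forall>n\<ge>N. (T ^^ n) v \<in> Q)"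

end

theory Submission
  imports Defs
begin

text \<open>A point with \<open>0 < a\<close> and \<open>2 * a \<le> b\<close> is moved straight down by \<open>2 * a\<close> under \<open>T_c\<close>, so it
  leaves that sector after finitely many steps. Every other nonzero point reaches
  the absorbing quadrant \<open>Q2\<close> in at most two steps. The central symmetry
  \<open>v \<mapsto> -v\<close> conjugates \<open>T_c\<close> to \<open>T_d\<close> and exchanges the two quadrants.\<close>

lemma flows_into_self:
  assumes "T ` Q \<subseteq> Q" "v \<in> Q"
  shows "flows_into T Q v"
proof -
  have "(T ^^ n) v \<in> Q" for n
    using assms by (induction n) auto
  then show ?thesis
    by (auto simp: flows_into_def)
qed

lemma flows_into_step:
  assumes "flows_into T Q (T v)"
  shows "flows_into T Q v"
proof -
  obtain N where N: "\<And>n. n \<ge> N \<Longrightarrow> (T ^^ n) (T v) \<in> Q"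
    using assms by (auto simp: flows_into_def)
  \<comment> \<open>The orbit of \<open>v\<close> is that of \<open>T v\<close> delayed by one step,
    hence the threshold \<open>Suc N\<close>.\<close>
  have "(T ^^ n) v \<in> Q" if "n \<ge> Suc N" for n
    using that N[of "n - 1"] by (cases n) (auto simp: funpow_swap1)
  then show ?thesis
    unfolding flows_into_def by blast
qed

text \<open>Used to pass from the formulas to \<open>coord_action\<close>, where agreement is known
  only off the origin: invariance of \<open>X\<close> keeps the whole orbit where the two maps
  agree.\<close>

lemma flows_into_cong:
  assumes "flows_into T Q v" "v \<in> X" "T ` X \<subseteq> X" "\<And>w. w \<in> X \<Longrightarrow> T' w = T w"
  shows "flows_into T' Q v"
proof -
  have "(T ^^ n) v \<in> X \<and> (T' ^^ n) v = (T ^^ n) v" for n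
    using assms(2-) by (induction n) auto
  then show ?thesis
    using assms(1) by (simp add: flows_into_def)
qed

lemma flows_into_conj:
  assumes "flows_into T Q v" "\<And>w. T' (g w) = g (T w)"
  shows "flows_into T' (g ` Q) (g v)"
proof -
  have "(T' ^^ n) (g v) = g ((T ^^ n) v)" for n
    using assms(2) by (induction n) auto
  then show ?thesis
    using assms(1) by (auto simp: flows_into_def)
qed

lemma Tc_formula_nonzero: "Tc_formula ` Z2_nonzero \<subseteq> Z2_nonzero"
  by (auto simp: Z2_nonzero_def split: if_splits)

text \<open>On \<open>Q2\<close> the map is (a, b) \<mapsto> (a, b - 2a), and -2a \<ge> 0
  there.\<close>

lemma Tc_formula_Q2: "Tc_formula ` Q2 \<subseteq> Q2"
  by (auto simp: Z2_nonzero_def Q2_def split: if_splits)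

text \<open>Both maps use the same linear pieces, and the sectors of one are the negatives of the
  sectors of the other.\<close>

lemma Td_formula_uminus: "Td_formula (- v) = - Tc_formula v"
  by (cases v) auto

lemma Q4_eq: "Q4 = uminus ` Q2"
proof -
  have "- v \<in> Q2 \<longleftrightarrow> v \<in> Q4" for v
    by (cases v) (simp add: Z2_nonzero_def Q2_def Q4_def)
  then show ?thesis
    by (metis (no_types) image_iff minus_minus subsetI subset_antisym)
qed

lemma Td_formula_nonzero: "Td_formula ` Z2_nonzero \<subseteq> Z2_nonzero"
  by (auto simp: Z2_nonzero_def split: if_splits)

lemma Td_formula_Q4: "Td_formula ` Q4 \<subseteq> Q4"
  by (auto simp: Z2_nonzero_def Q4_def split: if_splits)

text \<open>One step suffices: the image is (a + b, -2a - b), whose coordinates have the required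
  signs.\<close>

lemma flows_into_Q2_third_quadrant:
  assumes "(a, b) \<in> Z2_nonzero" "a \<le> 0" "b \<le> 0"
  shows "flows_into Tc_formula Q2 (a, b)"
proof -
  have "Tc_formula (a, b) \<in> Q2"
    using assms by (auto simp: Z2_nonzero_def Q2_def)
  then show ?thesis
    by (intro flows_into_step[OF flows_into_self] Tc_formula_Q2)
qed

lemma flows_into_Q2_below_diagonal:
  assumes "(a, b) \<in> Z2_nonzero" "a \<ge> 0" "b \<le> a"
  shows "flows_into Tc_formula Q2 (a, b)"
proof (rule flows_into_step)
  have T: "Tc_formula (a, b) = (b - a, - b)"
    using assms by simp
  show "flows_into Tc_formula Q2 (Tc_formula (a, b))"
  \<comment> \<open>Since b - a \<le> 0, the sign of -b decides whether the image is already in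
    \<open>Q2\<close> or still in the third quadrant.\<close>
  proof (cases "b \<le> 0")
    case True
    then have "(b - a, - b) \<in> Q2"
      using assms by (auto simp: Z2_nonzero_def Q2_def)
    then show ?thesis
      unfolding T by (intro flows_into_self Tc_formula_Q2)
  next
    case False
    then show ?thesis
      unfolding T using assms
      by (intro flows_into_Q2_third_quadrant) (auto simp: Z2_nonzero_def)
  qed
qed

lemma flows_into_Q2:
  assumes "(a, b) \<in> Z2_nonzero"
  shows "flows_into Tc_formula Q2 (a, b)"
  using assms
\<comment> \<open>Only the last of the five cases uses the induction hypothesis; a stays fixed
  there, so b alone is generalized.\<close>
proof (induction "nat b" arbitrary: b rule: less_induct)
  case less
  consider "a \<le> 0" "b \<le> 0" | "a \<le> 0" "b \<ge> 0" | "a > 0" "b \<le> a"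
    | "0 < a" "a < b" "b < 2 * a" | "0 < a" "2 * a \<le> b"
    by linarith
  then show ?case
  proof cases
    case 1
    then show ?thesis
      using less.prems by (intro flows_into_Q2_third_quadrant)
  next
    case 2
    then show ?thesis
      using less.prems by (intro flows_into_self Tc_formula_Q2) (auto simp: Q2_def)
  next
    case 3
    then show ?thesis
      using less.prems by (intro flows_into_Q2_below_diagonal) auto
  next
    case 4
    \<comment> \<open>The image lies below the diagonal because b - 2a < 0 < b - a.\<close>
    then have "flows_into Tc_formula Q2 (b - a, b - 2 * a)"
      by (intro flows_into_Q2_below_diagonal) (auto simp: Z2_nonzero_def)
    with 4 show ?thesis
      by (intro flows_into_step[of _ _ "(a, b)"]) simp
  next
    case 5
    \<comment> \<open>Here b \<ge> 2a > 0, so \<open>nat b\<close> strictly decreases, and a > 0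
      keeps the point off the origin.\<close>
    then have "flows_into Tc_formula Q2 (a, b - 2 * a)"
      by (intro less.hyps) (auto simp: Z2_nonzero_def)
    \<comment> \<open>On the ray b = 2a an earlier test of \<open>Tc_formula\<close> fires; both
      branches give (a, 0) there.\<close>
    moreover have "Tc_formula (a, b) = (a, b - 2 * a)"
      using 5 by (intro Tc_formula_cases(3)) auto
    ultimately show ?thesis
      by (intro flows_into_step[of _ _ "(a, b)"]) (simp only:)
  qed
qed

lemma flows_into_Q4:
  assumes "v \<in> Z2_nonzero"
  shows "flows_into Td_formula Q4 v"
proof -
  have "- v \<in> Z2_nonzero"
    using assms by (cases v) (simp add: Z2_nonzero_def)
  then have "flows_into Tc_formula Q2 (- v)"
    by (cases "- v") (simp add: flows_into_Q2)
  then have "flows_into Td_formula (uminus ` Q2) (- (- v))"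
    by (rule flows_into_conj) (rule Td_formula_uminus)
  then show ?thesis
    by (simp add: Q4_eq)
qed

text \<open>Surjectivity of \<open>dynnikov\<close> makes the chosen preimage of \<open>v\<close> a
  genuine class with coordinates \<open>v\<close>, to which the intertwining relation
  applies.\<close>

lemma coord_action_eq:
  assumes "bij_betw dynnikov S Z2_nonzero" "\<forall>L\<in>S. dynnikov (act t L) = T (dynnikov L)"
    and "v \<in> Z2_nonzero"
  shows "coord_action t v = T v"
proof -
  have "inv_into S dynnikov v \<in> S"
    using assms(1,3) by (metis bij_betw_imp_surj_on inv_into_into)
  moreover have "dynnikov (inv_into S dynnikov v) = v"
    by (rule bij_betw_inv_into_right[OF assms(1,3)])
  ultimately show ?thesis
    using assms(2) by (simp add: coord_action_def)
qed

theorem corollary1p3: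
  "(\<forall>v\<in>Z2_nonzero. flows_into Tc_formula Q2 v) \<and>
   (\<forall>v\<in>Z2_nonzero. flows_into Td_formula Q4 v) \<and>
   Tc_formula ` Q2 \<subseteq> Q2 \<and> Td_formula ` Q4 \<subseteq> Q4 \<and>
   (bij_betw dynnikov S Z2_nonzero \<and>
    (\<forall>L\<in>S. dynnikov (act t_c L) = Tc_formula (dynnikov L)) \<and>
    (\<forall>L\<in>S. dynnikov (act t_d L) = Td_formula (dynnikov L)) \<longrightarrow>
    (\<forall>v\<in>Z2_nonzero. flows_into (coord_action t_c) Q2 v) \<and>
    (\<forall>v\<in>Z2_nonzero. flows_into (coord_action t_d) Q4 v) \<and>
    coord_action t_c ` Q2 \<subseteq> Q2 \<and> coord_action t_d ` Q4 \<subseteq> Q4)"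
proof (intro conjI impI)
  show c: "\<forall>v\<in>Z2_nonzero. flows_into Tc_formula Q2 v"
    using flows_into_Q2 by auto
  show d: "\<forall>v\<in>Z2_nonzero. flows_into Td_formula Q4 v"
    using flows_into_Q4 by blast
  show "Tc_formula ` Q2 \<subseteq> Q2" "Td_formula ` Q4 \<subseteq> Q4"
    by (rule Tc_formula_Q2 Td_formula_Q4)+
  assume asm: "bij_betw dynnikov S Z2_nonzero \<and>
    (\<forall>L\<in>S. dynnikov (act t_c L) = Tc_formula (dynnikov L)) \<and>
    (\<forall>L\<in>S. dynnikov (act t_d L) = Td_formula (dynnikov L))"
  have eq_c: "coord_action t_c v = Tc_formula v" if "v \<in> Z2_nonzero" for v
    using asm that by (intro coord_action_eq) auto
  have eq_d: "coord_action t_d v = Td_formula v" if "v \<in> Z2_nonzero" for v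
    using asm that by (intro coord_action_eq) auto
  show "\<forall>v\<in>Z2_nonzero. flows_into (coord_action t_c) Q2 v"
    using c flows_into_cong[OF _ _ Tc_formula_nonzero eq_c] by blast
  show "\<forall>v\<in>Z2_nonzero. flows_into (coord_action t_d) Q4 v"
    using d flows_into_cong[OF _ _ Td_formula_nonzero eq_d] by blast
  have "Q2 \<subseteq> Z2_nonzero" "Q4 \<subseteq> Z2_nonzero"
    by (auto simp: Q2_def Q4_def)
  then show "coord_action t_c ` Q2 \<subseteq> Q2" "coord_action t_d ` Q4 \<subseteq> Q4"
    using Tc_formula_Q2 Td_formula_Q4 eq_c eq_d unfolding image_subset_iff by (metis subsetD)+
qed

end
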